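(* Let $\Gamma\cup\{A\}$ be a set of formulas without intuitionistic variables. Then $\Gamma\vdash_{pml}A$ if and only if $\Gamma\vdash_{(i')}A$.
   Context: Formulas. Let $\mathcal V_m$ (minimal variables), $\mathcal V_i$ (intuitionistic variables), $\mathcal V_c$ (classical variables) be three disjoint countable sets of propositional variables and $\perp$ a special constant; put $\mathcal P=\mathcal V_m\cup\mathcal V_i\cup\mathcal V_c\cup\{\perp\}$. Formulas are built inductively from elements of $\mathcal P$ using $\wedge,\vee,\to$; $\neg A$ abbreviates $A\to\perp$. $var(A)$ is the set of variables of $A$ (so $\perp$ is not counted). $A$ is a classical formula if $var(A)\subseteq\mathcal V_c$, and an intuitionistic formula if $var(A)\subseteq\mathcal V_i\cup\mathcal V_c$. "Without intuitionistic variables" means that no element of $\mathcal V_i$ occurs. The system PML. A simple sequent is $\Gamma\vdash A$ with $\Gamma\cup\{A\}$ a finite set of formulas; commas denote union. Rules ($j\in\{1,2\}$): (Ax) $A\vdash A$; (W) from $\Gamma\vdash A$ infer $\Gamma,B\vdash A$; ($\wedge_I$) from $\Gamma_1\vdash A_1$ and $\Gamma_2\vdash A_2$ infer $\Gamma_1,\Gamma_2\vdash A_1\wedge A_2$; ($\wedge_E$) from $\Gamma\vdash A_1\wedge A_2$ infer $\Gamma\vdash A_j$; ($\vee_I$) from $\Gamma\vdash A_j$ infer $\Gamma\vdash A_1\vee A_2$; ($\vee_E$) from $\Gamma_1\vdash A_1\vee A_2$, $\Gamma_2,A_1\vdash B$ and $\Gamma_3,A_2\vdash B$ infer $\Gamma_1,\Gamma_2,\Gamma_3\vdash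 B$; ($\to_I$) from $\Gamma,A_1\vdash A_2$ infer $\Gamma\vdash A_1\to A_2$; ($\to_E$) from $\Gamma_1\vdash A_1\to A_2$ and $\Gamma_2\vdash A_1$ infer $\Gamma_1,\Gamma_2\vdash A_2$; ($\perp_i$) from $\Gamma\vdash\perp$ infer $\Gamma\vdash A$, provided $A$ is an intuitionistic formula; ($\perp_c$) from $\Gamma\vdash\neg\neg A$ infer $\Gamma\vdash A$, provided $A$ is a classical formula. $\Gamma\vdash_{pml}A$ means that $\Gamma\vdash A$ is derivable with these rules. $\Gamma\vdash_{(i')}A$ means that it is derivable without using the rule $(\perp_i)$. For infinite $\Gamma$, each of these means that the corresponding relation holds for some finite subset of $\Gamma$. *)

theory Defs
  imports "HOL-Library.Countable"
begin

datatype ('m, 'i, 'c) pvar = MVar 'm | IVar 'i | CVar 'c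

(* The set function of the datatype is the paper's var(A); Bot contributes nothing to it. *)
datatype (var: 'v) form =
    Var 'v
  | Bot (\<open>\<^bold>\<bottom>\<close>)
  | Conj "'v form" "'v form" (infixr \<open>\<^bold>\<and>\<close> 65)
  | Disj "'v form" "'v form" (infixr \<open>\<^bold>\<or>\<close> 60)
  | Imp "'v form" "'v form" (infixr \<open>\<^bold>\<rightarrow>\<close> 55)

type_synonym ('m, 'i, 'c) fm = "('m, 'i, 'c) pvar form"

abbreviation Neg :: "'v form \<Rightarrow> 'v form" (\<open>\<^bold>\<not> _\<close> [70] 70) where
  "\<^bold>\<not> A \<equiv> A \<^bold>\<rightarrow> \<^bold>\<bottom>"

definition classical :: "('m, 'i, 'c) fm \<Rightarrow> bool" where
  "classical A \<longleftrightarrow> var A \<subseteq> range CVar"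

definition intuitionistic :: "('m, 'i, 'c) fm \<Rightarrow> bool" where
  "intuitionistic A \<longleftrightarrow> var A \<subseteq> range IVar \<union> range CVar"

definition without_int_vars :: "('m, 'i, 'c) fm \<Rightarrow> bool" where
  "without_int_vars A \<longleftrightarrow> var A \<inter> range IVar = {}"

(* Derivability of simple sequents. The flag bi says whether the rule Bot_i is available,
   so that "deriv False" is derivability without using Bot_i. Antecedents are finite in every
   derivable sequent, see deriv_finite. *)
inductive deriv :: "bool \<Rightarrow> ('m, 'i, 'c) fm set \<Rightarrow> ('m, 'i, 'c) fm \<Rightarrow> bool" for bi where
  Ax: "deriv bi {A} A"
| W: "deriv bi \<Gamma> A \<Longrightarrow> deriv bi (insert B \<Gamma>) A"
| Conj_I: "deriv bi \<Gamma>1 A1 \<Longrightarrow> deriv bi \<Gamma>2 A2 \<Longrightarrow> deriv bi (\<Gamma>1 \<union> \<Gamma>2) (A1 \<^bold>\<and> A2)"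
| Conj_E1: "deriv bi \<Gamma> (A1 \<^bold>\<and> A2) \<Longrightarrow> deriv bi \<Gamma> A1"
| Conj_E2: "deriv bi \<Gamma> (A1 \<^bold>\<and> A2) \<Longrightarrow> deriv bi \<Gamma> A2"
| Disj_I1: "deriv bi \<Gamma> A1 \<Longrightarrow> deriv bi \<Gamma> (A1 \<^bold>\<or> A2)"
| Disj_I2: "deriv bi \<Gamma> A2 \<Longrightarrow> deriv bi \<Gamma> (A1 \<^bold>\<or> A2)"
| Disj_E: "deriv bi \<Gamma>1 (A1 \<^bold>\<or> A2) \<Longrightarrow> deriv bi (insert A1 \<Gamma>2) B \<Longrightarrow> deriv bi (insert A2 \<Gamma>3) B
    \<Longrightarrow> deriv bi (\<Gamma>1 \<union> \<Gamma>2 \<union> \<Gamma>3) B"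
| Imp_I: "deriv bi (insert A1 \<Gamma>) A2 \<Longrightarrow> deriv bi \<Gamma> (A1 \<^bold>\<rightarrow> A2)"
| Imp_E: "deriv bi \<Gamma>1 (A1 \<^bold>\<rightarrow> A2) \<Longrightarrow> deriv bi \<Gamma>2 A1 \<Longrightarrow> deriv bi (\<Gamma>1 \<union> \<Gamma>2) A2"
| Bot_i: "bi \<Longrightarrow> deriv bi \<Gamma> \<^bold>\<bottom> \<Longrightarrow> intuitionistic A \<Longrightarrow> deriv bi \<Gamma> A"
| Bot_c: "deriv bi \<Gamma> (\<^bold>\<not> \<^bold>\<not> A) \<Longrightarrow> classical A \<Longrightarrow> deriv bi \<Gamma> A"

lemma deriv_finite: "deriv bi \<Gamma> A \<Longrightarrow> finite \<Gamma>"
  by (induction rule: deriv.induct) auto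

lemma deriv_weaken:
  assumes "deriv bi \<Delta> A" "\<Delta> \<subseteq> \<Gamma>" "finite \<Gamma>"
  shows "deriv bi \<Gamma> A"
proof -
  have "deriv bi (\<Delta> \<union> \<Theta>) A" if "finite \<Theta>" for \<Theta>
    using that by induction (auto intro: assms(1) deriv.W)
  from this[OF assms(3)] show ?thesis
    using assms(2) by (simp add: Un_absorb1)
qed

(* The extension to arbitrary, possibly infinite sets of hypotheses; on finite sets it
   agrees with derivability of the sequent, see pml_finite_iff and pml_i'_finite_iff. *)
definition pml :: "('m, 'i, 'c) fm set \<Rightarrow> ('m, 'i, 'c) fm \<Rightarrow> bool" (infix \<open>\<turnstile>\<^sub>p\<^sub>m\<^sub>l\<close> 50) where
  "\<Gamma> \<turnstile>\<^sub>p\<^sub>m\<^sub>l A \<longleftrightarrow> (\<exists>\<Delta>. finite \<Delta> \<and> \<Delta> \<subseteq> \<Gamma> \<and> deriv True \<Delta> A)"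

definition pml_i' :: "('m, 'i, 'c) fm set \<Rightarrow> ('m, 'i, 'c) fm \<Rightarrow> bool" (infix \<open>\<turnstile>\<^sub>i''\<close> 50) where
  "\<Gamma> \<turnstile>\<^sub>i' A \<longleftrightarrow> (\<exists>\<Delta>. finite \<Delta> \<and> \<Delta> \<subseteq> \<Gamma> \<and> deriv False \<Delta> A)"

lemma pml_finite_iff: "finite \<Gamma> \<Longrightarrow> \<Gamma> \<turnstile>\<^sub>p\<^sub>m\<^sub>l A \<longleftrightarrow> deriv True \<Gamma> A"
  unfolding pml_def by (blast intro: deriv_weaken)

lemma pml_i'_finite_iff: "finite \<Gamma> \<Longrightarrow> \<Gamma> \<turnstile>\<^sub>i' A \<longleftrightarrow> deriv False \<Gamma> A"
  unfolding pml_i'_def by (blast intro: deriv_weaken)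

end

theory Submission
  imports Defs
begin

text \<open>
  Substituting \<open>\<^bold>\<bottom>\<close> for every intuitionistic variable turns intuitionistic formulas into classical
  ones. Derivations survive this substitution: every rule other than \<open>Bot_i\<close> is schematic and
  keeps its form, with \<open>Bot_c\<close> still applied to a classical formula (\<open>classical_subst\<close>), while an
  instance of \<open>Bot_i\<close> becomes ex falso with a classical conclusion, which \<open>Bot_c\<close> provides
  (\<open>deriv_classical_ex_falso\<close>). So a derivation of \<open>\<Gamma> \<turnstile> A\<close> with \<open>Bot_i\<close> yields one without it for
  the substituted sequent (\<open>deriv_subst_eliminates_Bot_i\<close>), which is \<open>\<Gamma> \<turnstile> A\<close> itself when no
  intuitionistic variable occurs in it.
\<close>

primrec subst :: "('v \<Rightarrow> 'w form) \<Rightarrow> 'v form \<Rightarrow> 'w form" where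
  "subst \<sigma> (Var v) = \<sigma> v"
| "subst \<sigma> \<^bold>\<bottom> = \<^bold>\<bottom>"
| "subst \<sigma> (A \<^bold>\<and> B) = subst \<sigma> A \<^bold>\<and> subst \<sigma> B"
| "subst \<sigma> (A \<^bold>\<or> B) = subst \<sigma> A \<^bold>\<or> subst \<sigma> B"
| "subst \<sigma> (A \<^bold>\<rightarrow> B) = subst \<sigma> A \<^bold>\<rightarrow> subst \<sigma> B"

lemma subst_ident: "(\<And>v. v \<in> var A \<Longrightarrow> \<sigma> v = Var v) \<Longrightarrow> subst \<sigma> A = A"
  by (induction A) auto

lemma var_subst: "var (subst \<sigma> A) = (\<Union>v \<in> var A. var (\<sigma> v))"
  by (induction A) auto

lemma classical_subst: "(\<And>v. v \<in> var A \<Longrightarrow> classical (\<sigma> v)) \<Longrightarrow> classical (subst \<sigma> A)"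
  unfolding classical_def var_subst by blast

text \<open>Weakening a derivation of absurdity by \<open>\<^bold>\<not> A\<close> and discharging that hypothesis gives
  \<open>\<^bold>\<not> \<^bold>\<not> A\<close>, from which \<open>Bot_c\<close> concludes.\<close>

lemma deriv_classical_ex_falso:
  assumes "deriv bi \<Gamma> \<^bold>\<bottom>" "classical A"
  shows "deriv bi \<Gamma> A"
proof -
  have "deriv bi \<Gamma> (\<^bold>\<not> \<^bold>\<not> A)"
    using assms(1) by (intro deriv.Imp_I deriv.W)
  then show ?thesis
    using assms(2) by (rule deriv.Bot_c)
qed

text \<open>The images of minimal variables are unconstrained, because no side condition of a rule
  admits them. Classical images of the classical variables preserve the side condition of
  \<open>Bot_c\<close>; with classical images of the intuitionistic variables as well, the conclusion of every
  \<open>Bot_i\<close> becomes classical.\<close>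

lemma deriv_subst_eliminates_Bot_i:
  fixes \<sigma> :: "('m, 'i, 'c) pvar \<Rightarrow> ('n, 'j, 'd) fm"
  assumes "deriv bi \<Gamma> A"
    and int_var: "\<And>i. classical (\<sigma> (IVar i))"
    and cl_var: "\<And>c. classical (\<sigma> (CVar c))"
  shows "deriv False (subst \<sigma> ` \<Gamma>) (subst \<sigma> A)"
  using assms(1)
proof (induction rule: deriv.induct)
  case (Bot_i \<Gamma> A)
  have "classical (subst \<sigma> A)"
    using \<open>intuitionistic A\<close> int_var cl_var
    by (intro classical_subst) (auto simp: intuitionistic_def)
  with Bot_i show ?case
    by (auto intro: deriv_classical_ex_falso)
next
  case (Bot_c \<Gamma> A)
  have "classical (subst \<sigma> A)"
    using \<open>classical A\<close> cl_var by (intro classical_subst) (auto simp: classical_def)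
  with Bot_c show ?case
    by (auto intro: deriv.Bot_c)
qed (auto simp: image_Un intro: deriv.intros)

lemma deriv_without_Bot_i: "deriv False \<Gamma> A \<Longrightarrow> deriv bi \<Gamma> A"
  by (induction rule: deriv.induct) (auto intro: deriv.intros)

fun int_to_bot :: "('m, 'i, 'c) pvar \<Rightarrow> ('m, 'i, 'c) fm" where
  "int_to_bot (IVar i) = \<^bold>\<bottom>"
| "int_to_bot v = Var v"

lemma subst_int_to_bot_ident:
  assumes "without_int_vars A"
  shows "subst int_to_bot A = A"
proof (rule subst_ident)
  fix v assume "v \<in> var A"
  with assms show "int_to_bot v = Var v"
    by (cases v) (auto simp: without_int_vars_def)
qed

theorem theorem27:
  fixes \<Gamma> :: "('m::countable, 'i::countable, 'c::countable) fm set"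
    and A :: "('m, 'i, 'c) fm"
  assumes "\<forall>B \<in> \<Gamma> \<union> {A}. without_int_vars B"
  shows "\<Gamma> \<turnstile>\<^sub>p\<^sub>m\<^sub>l A \<longleftrightarrow> \<Gamma> \<turnstile>\<^sub>i' A"
proof
  assume "\<Gamma> \<turnstile>\<^sub>p\<^sub>m\<^sub>l A"
  then obtain \<Delta> where \<Delta>: "finite \<Delta>" "\<Delta> \<subseteq> \<Gamma>" "deriv True \<Delta> A"
    unfolding pml_def by blast
  have "deriv False (subst int_to_bot ` \<Delta>) (subst int_to_bot A)"
    using \<Delta>(3) by (rule deriv_subst_eliminates_Bot_i) (auto simp: classical_def)
  moreover have "subst int_to_bot B = B" if "B \<in> \<Delta> \<union> {A}" for B
    using that \<Delta>(2) assms by (intro subst_int_to_bot_ident) blast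
  ultimately have "deriv False \<Delta> A"
    by simp
  with \<Delta> show "\<Gamma> \<turnstile>\<^sub>i' A"
    unfolding pml_i'_def by blast
next
  assume "\<Gamma> \<turnstile>\<^sub>i' A"
  then show "\<Gamma> \<turnstile>\<^sub>p\<^sub>m\<^sub>l A"
    unfolding pml_def pml_i'_def by (blast intro: deriv_without_Bot_i)
qed

end
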